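(* Let $L\subseteq\mathbb{R}^n$ be an affine subspace with $L\cap\mathbb{R}^n_+\neq\emptyset$, and let $f$ be an FR sequence for the polyhedron $L\cap\mathbb{R}^n_+$. Then $f$ is minimal if and only if it is a longest FR sequence for $L\cap\mathbb{R}^n_+$ (i.e. its length equals the maximum length among all FR sequences for $L\cap\mathbb{R}^n_+$).
   Context: Here the cone is $K=\mathbb{R}^n_+$, the nonnegative orthant. For a cone $F$, $F^*=\{y\mid\langle y,x\rangle\ge 0\ \forall x\in F\}$. For a set $S$, $S^\perp=\{y\mid \langle y,x\rangle=0\ \forall x\in S\}$ (also when $S$ is an affine subspace), and $w^\perp:=\{w\}^\perp$. A nonempty convex subcone $F\subseteq K$ is a face of $K$ if $x,y\in K$ and $x+y\in F$ imply $x,y\in F$. FR sequences. Facial reduction for $L\cap K$: set $F_0=K$; for $i=1,2,\dots$, as long as $L^\perp\cap(F_{i-1}^*\setminus F_{i-1}^\perp)\neq\emptyset$, choose any $w_i\in L^\perp\cap(F_{i-1}^*\setminus F_{i-1}^\perp)$ and set $F_i=F_{i-1}\cap w_i^\perp$. The procedure is run until it terminates, i.e. until $L^\perp\cap(F_d^*\setminus F_d^\perp)=\emptyset$, at which point $F_d$ is the minimal face of $L\cap K$ (the smallest face of $K$ containing $L\cap K$). The resulting $(w_1,\dots,w_d)$ is called an FR sequence for $L\cap K$, of length $d$, with corresponding sequence of faces $(F_0,\dots,F_d)$, where $F_0\supsetneq\cdots\supsetneq F_d$. If the procedure terminates immediately, $d=0$ (empty sequence). Minimality. For a face $F$ of $K$,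 a vector $w$ is minimal for $L\cap F$ if $w\in L^\perp\cap(F^*\setminus F^\perp)$ and there is no $u\in L^\perp\cap(F^*\setminus F^\perp)$ with $F\cap w^\perp\subsetneq F\cap u^\perp$. An FR sequence $(w_1,\dots,w_d)$ with faces $(F_0,\dots,F_d)$ is minimal if $w_i$ is minimal for $L\cap F_{i-1}$ for all $i=1,\dots,d$. *)

theory Defs
  imports "HOL-Analysis.Analysis"
begin

definition nonneg_orthant :: "(real ^ 'n) set"
  where "nonneg_orthant = {x. \<forall>i. 0 \<le> x $ i}"

definition dual_cone :: "'a::real_inner set \<Rightarrow> 'a set"
  where "dual_cone F = {y. \<forall>x\<in>F. 0 \<le> y \<bullet> x}"

definition cone_face :: "'a::real_vector set \<Rightarrow> 'a set \<Rightarrow> bool"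
  where "cone_face F K \<longleftrightarrow> F \<noteq> {} \<and> F \<subseteq> K \<and> convex F \<and> cone F \<and>
    (\<forall>x\<in>K. \<forall>y\<in>K. x + y \<in> F \<longrightarrow> x \<in> F \<and> y \<in> F)"

text \<open>Here \<^const>\<open>orthogonal_comp\<close> is applied to arbitrary sets: for an affine \<open>L\<close> it consists of
  the vectors orthogonal to all points of \<open>L\<close>, not just to the directions of \<open>L\<close>.\<close>

definition reducing :: "'a::real_inner set \<Rightarrow> 'a set \<Rightarrow> 'a set"
  where "reducing L F = orthogonal_comp L \<inter> (dual_cone F - orthogonal_comp F)"

text \<open>The list \<open>ws\<close> is indexed from 0, so its entry \<open>ws ! i\<close> is $w_{i+1}$ and leads from
  $F_i$ to $F_{i+1}$.\<close>

primrec fr_face :: "'a::real_inner set \<Rightarrow> 'a list \<Rightarrow> nat \<Rightarrow> 'a set"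
  where
    "fr_face K ws 0 = K"
  | "fr_face K ws (Suc i) = fr_face K ws i \<inter> orthogonal_comp {ws ! i}"

text \<open>The last conjunct says that the procedure has been run until it terminates.\<close>

definition fr_sequence :: "'a::real_inner set \<Rightarrow> 'a set \<Rightarrow> 'a list \<Rightarrow> bool"
  where "fr_sequence K L ws \<longleftrightarrow>
    (\<forall>i<length ws. ws ! i \<in> reducing L (fr_face K ws i)) \<and>
    reducing L (fr_face K ws (length ws)) = {}"

definition minimal_reducing :: "'a::real_inner set \<Rightarrow> 'a set \<Rightarrow> 'a \<Rightarrow> bool"
  where "minimal_reducing L F w \<longleftrightarrow> w \<in> reducing L F \<and>
    \<not> (\<exists>u\<in>reducing L F. F \<inter> orthogonal_comp {w} \<subset> F \<inter> orthogonal_comp {u})"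

definition minimal_fr_sequence :: "'a::real_inner set \<Rightarrow> 'a set \<Rightarrow> 'a list \<Rightarrow> bool"
  where "minimal_fr_sequence K L ws \<longleftrightarrow> fr_sequence K L ws \<and>
    (\<forall>i<length ws. minimal_reducing L (fr_face K ws i) (ws ! i))"

definition longest_fr_sequence :: "'a::real_inner set \<Rightarrow> 'a set \<Rightarrow> 'a list \<Rightarrow> bool"
  where "longest_fr_sequence K L ws \<longleftrightarrow> fr_sequence K L ws \<and>
    (\<forall>vs. fr_sequence K L vs \<longrightarrow> length vs \<le> length ws)"

text \<open>\<^const>\<open>minimal_reducing\<close> is meant for faces \<open>F\<close> of \<open>K\<close>; it is only applied to the sets
  \<^const>\<open>fr_face\<close>, which are faces by the lemma below.\<close>

lemma cone_face_nonneg_orthant: "cone_face nonneg_orthant (nonneg_orthant :: (real ^ 'n) set)"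
  by (auto simp: cone_face_def nonneg_orthant_def convex_def cone_def intro!: exI[of _ 0])

lemma cone_face_fr_face:
  assumes "fr_sequence K L ws" "cone_face K K" "i \<le> length ws"
  shows "cone_face (fr_face K ws i) K"
  using assms(3)
proof (induction i)
  case 0
  show ?case using assms(2) by simp
next
  case (Suc i)
  let ?F = "fr_face K ws i" and ?w = "ws ! i"
  have F: "cone_face ?F K" using Suc by simp
  have nonneg: "0 \<le> ?w \<bullet> x" if "x \<in> ?F" for x
    using assms(1) Suc.prems that
    unfolding fr_sequence_def reducing_def dual_cone_def by auto
  have perp: "orthogonal_comp {?w} = {x. ?w \<bullet> x = 0}"
    by (auto simp: orthogonal_comp_def orthogonal_def)
  have "0 \<in> ?F" using F cone_contains_0[of ?F] by (simp add: cone_face_def)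
  then have "?F \<inter> {x. ?w \<bullet> x = 0} \<noteq> {}" by force
  moreover have "convex (?F \<inter> {x. ?w \<bullet> x = 0})"
    using F by (intro convex_Int convex_hyperplane) (simp add: cone_face_def)
  moreover have "cone (?F \<inter> {x. ?w \<bullet> x = 0})"
    using F by (simp add: cone_face_def cone_def)
  moreover have "x \<in> ?F \<and> y \<in> ?F \<and> ?w \<bullet> x = 0 \<and> ?w \<bullet> y = 0"
    if xy: "x \<in> K" "y \<in> K" "x + y \<in> ?F" "?w \<bullet> (x + y) = 0" for x y
  proof -
    have *: "x \<in> ?F" "y \<in> ?F" using F xy(1-3) by (simp_all add: cone_face_def)
    show ?thesis using * nonneg[OF *(1)] nonneg[OF *(2)] xy(4) by (simp add: inner_add_right)
  qed
  moreover have "?F \<subseteq> K" using F by (simp add: cone_face_def)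
  ultimately show ?case unfolding cone_face_def fr_face.simps perp by blast
qed

end

theory Submission imports Defs begin

text \<open>Why the theorem holds. A face of the orthant is given by the set \<open>I\<close> of coordinates that are
  not forced to vanish on it. A vector reduces this face if and only if it lies in \<open>L\<^sup>\<bottom>\<close> and its restriction
  to \<open>I\<close> is nonnegative and nonzero; the reduction removes from \<open>I\<close> the coordinates where that
  vector is positive. So a sequence \<open>w\<^sub>1, \<dots>, w\<^sub>d\<close> produces index sets
  \<open>I\<^sub>0 \<supset> \<dots> \<supset> I\<^sub>d\<close>, where \<open>I\<^sub>0\<close> contains all coordinates. To each \<open>I\<close> belongs the subspace
  \<open>V(I)\<close> of the vectors of \<open>L\<^sup>\<bottom>\<close> that vanish on \<open>I\<close>, and the length of a sequence is compared with
  the dimension of these subspaces.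

  As \<open>w\<^sub>i\<close> lies in \<open>V(I\<^sub>i)\<close> but not in \<open>V(I\<^sub>i\<^sub>-\<^sub>1)\<close>, the dimension grows by at least one in each
  step, so that \<open>d \<le> dim V(I\<^sub>d)\<close>. If \<open>w\<^sub>i\<close> is minimal, then the dimension grows by exactly
  one: for \<open>v \<in> V(I\<^sub>i)\<close>, the smallest \<open>t\<close> with \<open>t w\<^sub>i - v \<ge> 0\<close> on \<open>I\<^sub>i\<^sub>-\<^sub>1\<close> makes this vector
  vanish at a further coordinate, which contradicts minimality unless the vector vanishes on all
  of \<open>I\<^sub>i\<^sub>-\<^sub>1\<close>, that is, unless \<open>v\<close> lies in the span of \<open>w\<^sub>i\<close> and \<open>V(I\<^sub>i\<^sub>-\<^sub>1)\<close>. Hence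
  \<open>d = dim V(I\<^sub>d)\<close> for a minimal sequence. All sequences end with the same set \<open>I\<^sub>d\<close>, so minimal
  sequences are longest (\<open>minimal_imp_longest\<close>).

  The converse is true for every set in place of the orthant (\<open>longest_imp_minimal\<close>): if some \<open>u\<close>
  witnesses that \<open>w\<^sub>i\<close> is not minimal, then \<open>u\<close> can be inserted just before \<open>w\<^sub>i\<close>, which gives a
  longer sequence.\<close>

section \<open>Longest sequences are minimal\<close>

lemma mem_orthogonal_comp_singleton: "x \<in> orthogonal_comp {w} \<longleftrightarrow> w \<bullet> x = 0"
  by (auto simp: orthogonal_comp_def orthogonal_def)

lemma mem_orthogonal_comp: "w \<in> orthogonal_comp S \<longleftrightarrow> (\<forall>x\<in>S. w \<bullet> x = 0)"
  by (auto simp: orthogonal_comp_def orthogonal_def inner_commute)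

lemma fr_face_eq: "fr_face K ws i = {x\<in>K. \<forall>j<i. ws ! j \<bullet> x = 0}"
  by (induction i) (auto simp: mem_orthogonal_comp_singleton less_Suc_eq)

text \<open>Write \<open>w\<close> for the entry \<open>ws ! i\<close>. Passing first to the larger face cut out by \<open>u\<close> leaves \<open>w\<close>
  reducing, because \<open>w\<close> does not vanish on that face; after \<open>w\<close> the original faces are reached
  again, because the face cut out by \<open>w\<close> is already orthogonal to \<open>u\<close>.\<close>

lemma fr_sequence_insert:
  assumes fr: "fr_sequence K L ws" and i: "i < length ws"
    and u: "u \<in> reducing L (fr_face K ws i)"
    and strict: "fr_face K ws i \<inter> orthogonal_comp {ws ! i} \<subset> fr_face K ws i \<inter> orthogonal_comp {u}"
  shows "fr_sequence K L (take i ws @ u # drop i ws)"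
proof -
  define vs where "vs = take i ws @ u # drop i ws"
  have len: "length vs = Suc (length ws)"
    using i by (simp add: vs_def)
  have before: "vs ! j = ws ! j" if "j < i" for j
    using that i by (simp add: vs_def nth_append)
  have at: "vs ! i = u"
    using i by (simp add: vs_def nth_append)
  have after: "vs ! Suc j = ws ! j" if "i \<le> j" for j
    using that i by (simp add: vs_def nth_append Suc_diff_le)
  have face_before: "fr_face K vs j = fr_face K ws j" if "j \<le> i" for j
    using that before by (auto simp: fr_face_eq)
  have face_u: "fr_face K vs (Suc i) = fr_face K ws i \<inter> orthogonal_comp {u}"
    by (simp add: face_before at)
  have face_after: "fr_face K vs (Suc (Suc j)) = fr_face K ws (Suc j)" if "i \<le> j" for j
    using that
  proof (induction j rule: dec_induct)
    case base
    show ?case using strict by (auto simp: face_u after face_before at)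
  next
    case (step j)
    then show ?case by (simp only: fr_face.simps(2)[of K vs "Suc (Suc j)"]
          fr_face.simps(2)[of K ws "Suc j"] after[of "Suc j"] le_SucI)
  qed
  have red: "ws ! j \<in> reducing L (fr_face K ws j)" if "j < length ws" for j
    using fr that by (simp add: fr_sequence_def)
  have "vs ! j \<in> reducing L (fr_face K vs j)" if "j < length vs" for j
  proof -
    consider "j < i" | "j = i" | "j = Suc i" | k where "j = Suc (Suc k)" "i \<le> k"
    proof -
      have "j < i \<or> j = i \<or> j = Suc i \<or> (j = Suc (Suc (j - 2)) \<and> i \<le> j - 2)"
        by arith
      then show thesis using that by blast
    qed
    then show ?thesis
    proof cases
      case 1
      then show ?thesis using red i by (simp add: before face_before)
    next
      case 2
      then show ?thesis using u by (simp add: at face_before)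
    next
      case 3
      have "ws ! i \<in> orthogonal_comp L" "ws ! i \<in> dual_cone (fr_face K ws i)"
        using red[OF i] by (auto simp: reducing_def)
      moreover have "ws ! i \<notin> orthogonal_comp (fr_face K vs (Suc i))"
      proof
        assume "ws ! i \<in> orthogonal_comp (fr_face K vs (Suc i))"
        then have "fr_face K ws i \<inter> orthogonal_comp {u} \<subseteq> orthogonal_comp {ws ! i}"
          unfolding face_u by (auto simp only: mem_orthogonal_comp[of "ws ! i"]
              mem_orthogonal_comp_singleton[of _ "ws ! i"])
        then show False using strict by blast
      qed
      ultimately have "ws ! i \<in> reducing L (fr_face K vs (Suc i))"
        unfolding reducing_def face_u dual_cone_def by blast
      then show ?thesis unfolding 3 by (simp only: after order_refl)
    next
      case 4
      then have "vs ! j = ws ! Suc k" "fr_face K vs j = fr_face K ws (Suc k)" "Suc k < length ws"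
        using face_after[of k] after[of "Suc k"] that len by (simp_all del: fr_face.simps)
      then show ?thesis using red by metis
    qed
  qed
  moreover have "reducing L (fr_face K vs (length vs)) = {}"
  proof -
    obtain k where "length ws = Suc k" "i \<le> k"
      using i by (cases "length ws") simp_all
    then have "fr_face K vs (length vs) = fr_face K ws (length ws)"
      by (simp only: len face_after)
    then show ?thesis
      using fr by (simp add: fr_sequence_def)
  qed
  ultimately show ?thesis
    unfolding fr_sequence_def vs_def[symmetric] by blast
qed

lemma longest_imp_minimal:
  assumes longest: "longest_fr_sequence K L ws"
  shows "minimal_fr_sequence K L ws"
proof -
  have fr: "fr_sequence K L ws"
    using longest by (simp add: longest_fr_sequence_def)
  have "minimal_reducing L (fr_face K ws i) (ws ! i)" if i: "i < length ws" for i
  proof (rule ccontr)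
    assume "\<not> ?thesis"
    then obtain u where "u \<in> reducing L (fr_face K ws i)"
      "fr_face K ws i \<inter> orthogonal_comp {ws ! i} \<subset> fr_face K ws i \<inter> orthogonal_comp {u}"
      using fr i unfolding minimal_reducing_def fr_sequence_def by blast
    then have "fr_sequence K L (take i ws @ u # drop i ws)"
      by (rule fr_sequence_insert[OF fr i])
    then have "length (take i ws @ u # drop i ws) \<le> length ws"
      using longest unfolding longest_fr_sequence_def by blast
    then show False using i by simp
  qed
  then show ?thesis using fr by (simp add: minimal_fr_sequence_def)
qed

section \<open>Faces of the orthant as index sets\<close>

definition coord_face :: "'n set \<Rightarrow> (real ^ 'n) set"
  where "coord_face I = {x \<in> nonneg_orthant. \<forall>k. k \<notin> I \<longrightarrow> x $ k = 0}"

lemma axis_mem_coord_face: "axis k 1 \<in> coord_face I \<longleftrightarrow> k \<in> I"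
  by (auto simp: coord_face_def nonneg_orthant_def axis_def)

lemma inner_eq_sum_coord_face: "w \<bullet> x = (\<Sum>k\<in>I. w $ k * x $ k)" if "x \<in> coord_face I"
  unfolding inner_vec_def using that
  by (auto simp: coord_face_def intro!: sum.mono_neutral_cong_right)

lemma coord_face_psubset:
  assumes "I \<subset> J"
  shows "coord_face I \<subset> coord_face J"
proof -
  obtain k where "k \<in> J" "k \<notin> I" using assms by blast
  then have "axis k 1 \<in> coord_face J - coord_face I"
    by (simp add: axis_mem_coord_face)
  moreover have "coord_face I \<subseteq> coord_face J"
    using assms by (auto simp: coord_face_def)
  ultimately show ?thesis by blast
qed

lemma mem_reducing_coord_face:
  "w \<in> reducing L (coord_face I) \<longleftrightarrow>
    w \<in> orthogonal_comp L \<and> (\<forall>k\<in>I. 0 \<le> w $ k) \<and> (\<exists>k\<in>I. w $ k \<noteq> 0)"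
proof -
  have dual: "w \<in> dual_cone (coord_face I) \<longleftrightarrow> (\<forall>k\<in>I. 0 \<le> w $ k)"
  proof
    assume "w \<in> dual_cone (coord_face I)"
    then have "0 \<le> w \<bullet> axis k 1" if "k \<in> I" for k
      using that by (simp add: dual_cone_def axis_mem_coord_face)
    then show "\<forall>k\<in>I. 0 \<le> w $ k" by (simp add: inner_axis)
  next
    assume nonneg: "\<forall>k\<in>I. 0 \<le> w $ k"
    have "0 \<le> w \<bullet> x" if x: "x \<in> coord_face I" for x
      unfolding inner_eq_sum_coord_face[OF x]
      using nonneg x by (intro sum_nonneg) (simp add: coord_face_def nonneg_orthant_def)
    then show "w \<in> dual_cone (coord_face I)"
      by (simp add: dual_cone_def)
  qed
  have perp: "w \<in> orthogonal_comp (coord_face I) \<longleftrightarrow> (\<forall>k\<in>I. w $ k = 0)"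
  proof
    assume "w \<in> orthogonal_comp (coord_face I)"
    then have "w \<bullet> axis k 1 = 0" if "k \<in> I" for k
      using that by (simp add: mem_orthogonal_comp axis_mem_coord_face)
    then show "\<forall>k\<in>I. w $ k = 0" by (simp add: inner_axis)
  next
    assume "\<forall>k\<in>I. w $ k = 0"
    then show "w \<in> orthogonal_comp (coord_face I)"
      by (simp add: mem_orthogonal_comp inner_eq_sum_coord_face)
  qed
  show ?thesis unfolding reducing_def using dual perp by blast
qed

text \<open>The inner product with \<open>w\<close> on the face is a sum of nonnegative terms, so it vanishes only if
  every term does.\<close>

lemma coord_face_Int_perp:
  assumes nonneg: "\<forall>k\<in>I. 0 \<le> w $ k"
  shows "coord_face I \<inter> orthogonal_comp {w} = coord_face {k\<in>I. w $ k = 0}"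
proof -
  have "w \<bullet> x = 0 \<longleftrightarrow> (\<forall>k. w $ k \<noteq> 0 \<longrightarrow> x $ k = 0)" if x: "x \<in> coord_face I" for x
  proof -
    have "w \<bullet> x = 0 \<longleftrightarrow> (\<forall>k\<in>I. w $ k * x $ k = 0)"
      unfolding inner_eq_sum_coord_face[OF x]
      using nonneg x
      by (intro sum_nonneg_eq_0_iff) (simp_all add: coord_face_def nonneg_orthant_def)
    then show ?thesis using x by (auto simp: coord_face_def)
  qed
  then show ?thesis
    by (auto simp: mem_orthogonal_comp_singleton) (auto simp: coord_face_def)
qed

definition zero_coords :: "(real ^ 'n) list \<Rightarrow> nat \<Rightarrow> 'n set"
  where "zero_coords ws i = {k. \<forall>j<i. ws ! j $ k = 0}"

lemma zero_coords_0: "zero_coords ws 0 = UNIV"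
  by (simp add: zero_coords_def)

lemma zero_coords_Suc: "zero_coords ws (Suc i) = {k \<in> zero_coords ws i. ws ! i $ k = 0}"
  by (auto simp: zero_coords_def less_Suc_eq)

lemma fr_face_eq_coord_face:
  assumes fr: "fr_sequence nonneg_orthant L ws" and "i \<le> length ws"
  shows "fr_face nonneg_orthant ws i = coord_face (zero_coords ws i)"
  using assms(2)
proof (induction i)
  case 0
  then show ?case by (simp add: zero_coords_0 coord_face_def)
next
  case (Suc i)
  have "ws ! i \<in> reducing L (fr_face nonneg_orthant ws i)"
    using fr Suc.prems by (simp add: fr_sequence_def)
  then have "ws ! i \<in> reducing L (coord_face (zero_coords ws i))"
    using Suc by simp
  then show ?case using Suc
    by (simp add: zero_coords_Suc mem_reducing_coord_face coord_face_Int_perp)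
qed

lemma fr_sequence_step:
  assumes "fr_sequence nonneg_orthant L ws" "i < length ws"
  shows "ws ! i \<in> reducing L (coord_face (zero_coords ws i))"
proof -
  have "ws ! i \<in> reducing L (fr_face nonneg_orthant ws i)"
    using assms by (simp add: fr_sequence_def)
  then show ?thesis
    using fr_face_eq_coord_face[OF assms(1), of i] assms(2) by simp
qed

lemma fr_sequence_terminal:
  assumes "fr_sequence nonneg_orthant L ws"
  shows "reducing L (coord_face (zero_coords ws (length ws))) = {}"
  using assms fr_face_eq_coord_face[OF assms, of "length ws"] by (simp add: fr_sequence_def)

text \<open>No entry of \<open>ws\<close> can be nonzero on the terminal index set \<open>I\<close> of \<open>vs\<close>: the first such entry
  would be nonnegative on \<open>I\<close> and so would reduce a face that cannot be reduced.\<close>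

lemma terminal_zero_coords_subset:
  assumes vs: "fr_sequence nonneg_orthant L vs" and ws: "fr_sequence nonneg_orthant L ws"
    and "i \<le> length ws"
  shows "zero_coords vs (length vs) \<subseteq> zero_coords ws i"
  using assms(3)
proof (induction i)
  case 0
  then show ?case by (simp add: zero_coords_0)
next
  case (Suc i)
  let ?I = "zero_coords vs (length vs)"
  have sub: "?I \<subseteq> zero_coords ws i"
    using Suc by simp
  have "ws ! i \<in> reducing L (coord_face (zero_coords ws i))"
    using fr_sequence_step[OF ws] Suc.prems by simp
  then have "ws ! i \<in> orthogonal_comp L" "\<forall>k\<in>?I. 0 \<le> ws ! i $ k"
    using sub by (auto simp: mem_reducing_coord_face)
  moreover have "ws ! i \<notin> reducing L (coord_face ?I)"
    using fr_sequence_terminal[OF vs] by simp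
  ultimately have "\<forall>k\<in>?I. ws ! i $ k = 0"
    unfolding mem_reducing_coord_face by blast
  then show ?case using sub by (auto simp: zero_coords_Suc)
qed

lemma terminal_zero_coords_unique:
  assumes "fr_sequence nonneg_orthant L vs" "fr_sequence nonneg_orthant L ws"
  shows "zero_coords vs (length vs) = zero_coords ws (length ws)"
  using terminal_zero_coords_subset[OF assms] terminal_zero_coords_subset[OF assms(2,1)] by blast

section \<open>Dimension counting\<close>

definition vanishing :: "(real ^ 'n) set \<Rightarrow> 'n set \<Rightarrow> (real ^ 'n) set"
  where "vanishing L I = {v \<in> orthogonal_comp L. \<forall>k\<in>I. v $ k = 0}"

lemma subspace_vanishing: "subspace (vanishing L I)"
  by (auto simp: subspace_def vanishing_def mem_orthogonal_comp inner_add_left)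

lemma length_le_dim_vanishing:
  assumes fr: "fr_sequence nonneg_orthant L ws" and "i \<le> length ws"
  shows "i \<le> dim (vanishing L (zero_coords ws i))"
  using assms(2)
proof (induction i)
  case (Suc i)
  let ?V = "\<lambda>i. vanishing L (zero_coords ws i)"
  have "ws ! i \<in> reducing L (coord_face (zero_coords ws i))"
    using fr_sequence_step[OF fr] Suc.prems by simp
  then have "ws ! i \<in> ?V (Suc i)" "ws ! i \<notin> ?V i"
    by (auto simp: mem_reducing_coord_face vanishing_def zero_coords_Suc)
  moreover have "?V i \<subseteq> ?V (Suc i)"
    by (auto simp: vanishing_def zero_coords_Suc)
  ultimately have "?V i \<subset> ?V (Suc i)" by blast
  then have "dim (?V i) < dim (?V (Suc i))"
    by (intro dim_psubset) (simp add: span_eq_iff[THEN iffD2, OF subspace_vanishing])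
  then show ?case using Suc by simp
qed simp

text \<open>A ratio test: with \<open>t\<close> the largest value of \<open>v\<^sub>k / w\<^sub>k\<close> over the coordinates in \<open>I\<close> where
  \<open>w\<^sub>k > 0\<close>, the vector \<open>t w - v\<close> is nonnegative on \<open>I\<close> and vanishes there on strictly more
  coordinates than \<open>w\<close>. By minimality it cannot be reducing, so it lies in \<open>vanishing L I\<close>.\<close>

lemma minimal_reducing_span:
  assumes min: "minimal_reducing L (coord_face I) w"
  shows "vanishing L {k\<in>I. w $ k = 0} \<subseteq> span (insert w (vanishing L I))"
proof
  fix v assume v: "v \<in> vanishing L {k\<in>I. w $ k = 0}"
  have w: "w \<in> orthogonal_comp L" "\<forall>k\<in>I. 0 \<le> w $ k" "\<exists>k\<in>I. w $ k \<noteq> 0"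
    using min by (auto simp: minimal_reducing_def mem_reducing_coord_face)
  define S where "S = {k\<in>I. w $ k \<noteq> 0}"
  define t where "t = Max ((\<lambda>k. v $ k / w $ k) ` S)"
  define u where "u = t *\<^sub>R w - v"
  have "S \<noteq> {}" using w(3) by (auto simp: S_def)
  then have "t \<in> (\<lambda>k. v $ k / w $ k) ` S"
    unfolding t_def by (intro Max_in) auto
  then obtain m where m: "m \<in> S" "t = v $ m / w $ m" by blast
  have u_perp: "u \<in> orthogonal_comp L"
    using v w(1) by (auto simp: u_def vanishing_def mem_orthogonal_comp inner_diff_left)
  have u_zero: "u $ k = 0" if "k \<in> I" "w $ k = 0" for k
    using v that by (simp add: u_def vanishing_def)
  have u_m: "u $ m = 0"
    using m by (simp add: u_def S_def)
  have u_nonneg: "\<forall>k\<in>I. 0 \<le> u $ k"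
  proof
    fix k assume k: "k \<in> I"
    show "0 \<le> u $ k"
    proof (cases "w $ k = 0")
      case True
      then show ?thesis using u_zero k by simp
    next
      case False
      then have "0 < w $ k" using w(2) k by (simp add: less_le)
      moreover have "v $ k / w $ k \<le> t"
        unfolding t_def using False k by (intro Max_ge) (auto simp: S_def)
      ultimately show ?thesis by (simp add: u_def divide_le_eq)
    qed
  qed
  have "\<forall>k\<in>I. u $ k = 0"
  proof (rule ccontr)
    assume "\<not> (\<forall>k\<in>I. u $ k = 0)"
    then have "u \<in> reducing L (coord_face I)"
      using u_perp u_nonneg by (auto simp: mem_reducing_coord_face)
    moreover have "{k\<in>I. w $ k = 0} \<subset> {k\<in>I. u $ k = 0}"
      using u_zero u_m m(1) by (auto simp: S_def)
    then have "coord_face I \<inter> orthogonal_comp {w} \<subset> coord_face I \<inter> orthogonal_comp {u}"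
      unfolding coord_face_Int_perp[OF w(2)] coord_face_Int_perp[OF u_nonneg]
      by (rule coord_face_psubset)
    ultimately show False using min unfolding minimal_reducing_def by blast
  qed
  then have "u \<in> vanishing L I"
    using u_perp by (simp add: vanishing_def)
  then have "t *\<^sub>R w - u \<in> span (insert w (vanishing L I))"
    by (intro span_diff span_scale span_base) auto
  then show "v \<in> span (insert w (vanishing L I))"
    by (simp add: u_def)
qed

lemma dim_vanishing_le_length:
  assumes min: "minimal_fr_sequence nonneg_orthant L ws" and "i \<le> length ws"
  shows "dim (vanishing L (zero_coords ws i)) \<le> i"
  using assms(2)
proof (induction i)
  case 0
  have "vanishing L UNIV \<subseteq> {0}"
    by (auto simp: vanishing_def vec_eq_iff)
  then show ?case by (simp add: zero_coords_0 dim_eq_0)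
next
  case (Suc i)
  let ?V = "\<lambda>i. vanishing L (zero_coords ws i)"
  have fr: "fr_sequence nonneg_orthant L ws"
    using min by (simp add: minimal_fr_sequence_def)
  have "minimal_reducing L (fr_face nonneg_orthant ws i) (ws ! i)"
    using min Suc.prems by (simp add: minimal_fr_sequence_def)
  then have "minimal_reducing L (coord_face (zero_coords ws i)) (ws ! i)"
    using fr_face_eq_coord_face[OF fr, of i] Suc.prems by simp
  then have "?V (Suc i) \<subseteq> span (insert (ws ! i) (?V i))"
    unfolding zero_coords_Suc by (rule minimal_reducing_span)
  then have "dim (?V (Suc i)) \<le> dim (insert (ws ! i) (?V i))"
    by (rule dim_mono)
  also have "\<dots> \<le> Suc (dim (?V i))"
    by (simp add: dim_insert)
  finally show ?case using Suc by simp
qed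

lemma minimal_imp_longest:
  assumes min: "minimal_fr_sequence nonneg_orthant L ws"
  shows "longest_fr_sequence nonneg_orthant L ws"
proof -
  have ws: "fr_sequence nonneg_orthant L ws"
    using min by (simp add: minimal_fr_sequence_def)
  have "length vs \<le> length ws" if vs: "fr_sequence nonneg_orthant L vs" for vs
  proof -
    have "length vs \<le> dim (vanishing L (zero_coords vs (length vs)))"
      by (rule length_le_dim_vanishing[OF vs order_refl])
    also have "\<dots> = dim (vanishing L (zero_coords ws (length ws)))"
      by (simp only: terminal_zero_coords_unique[OF vs ws])
    also have "\<dots> \<le> length ws"
      by (rule dim_vanishing_le_length[OF min order_refl])
    finally show ?thesis .
  qed
  then show ?thesis using ws by (simp add: longest_fr_sequence_def)
qed

theorem theorem4p3:
  fixes L :: "(real ^ 'n) set" and f :: "(real ^ 'n) list"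
  assumes "affine L"
    and "L \<inter> nonneg_orthant \<noteq> {}"
    and "fr_sequence nonneg_orthant L f"
  shows "minimal_fr_sequence nonneg_orthant L f \<longleftrightarrow> longest_fr_sequence nonneg_orthant L f"
  using minimal_imp_longest longest_imp_minimal by blast

end
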